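(* Let $N$ be a sequenceable finite group of odd order and let $k\ge 0$ be an integer. Then $N\times(\mathbb{Z}_2)^k$ has a cyclic D-sequence.
   Context: All groups are finite; $1_G$ denotes the identity of a group $G$; $\mathbb{Z}_2$ is the cyclic group of order $2$. For a sequence ${\bf g}: g_0,\ldots,g_m$ in a group $G$ with $g_0=1_G$, the sequence of consecutive quotients ${\bf \bar g}:\bar g_0,\ldots,\bar g_m$ is defined by $\bar g_0=1_G$ and $\bar g_i=g_{i-1}^{-1}g_i$ for $1\le i\le m$. A finite group $G$ of order $n$ is sequenceable if there is a sequence ${\bf g}: g_0,\ldots,g_{n-1}$ in $G$ with $g_0=1_G$ such that every element of $G$ appears exactly once in each of ${\bf g}$ and ${\bf \bar g}$. A D-sequence in a finite group $G$ of order $n$ is a sequence ${\bf g}: g_0,\ldots,g_{2n-1}$ in $G$ with $g_0=1_G$ such that every element of $G$ appears exactly twice in each of ${\bf g}$ and ${\bf \bar g}$. A D-sequence is cyclic if $g_{2n-1}=1_G$. *)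

theory Defs
  imports "HOL-Algebra.Product_Groups"
begin

definition quotient_seq :: "('a, 'b) monoid_scheme \<Rightarrow> 'a list \<Rightarrow> 'a list" where
  "quotient_seq G gs =
     map (\<lambda>i. if i = 0 then \<one>\<^bsub>G\<^esub> else inv\<^bsub>G\<^esub> (gs ! (i - 1)) \<otimes>\<^bsub>G\<^esub> (gs ! i)) [0..<length gs]"

text \<open>The notions below are meant for finite groups \<open>G\<close> only; the group axioms and finiteness
  are not built into them and are assumed where they are used.\<close>

definition sequenceable :: "('a, 'b) monoid_scheme \<Rightarrow> bool" where
  "sequenceable G \<longleftrightarrow>
     (\<exists>gs. length gs = order G \<and> set gs \<subseteq> carrier G \<and> gs ! 0 = \<one>\<^bsub>G\<^esub> \<and>
       (\<forall>x\<in>carrier G. count_list gs x = 1 \<and> count_list (quotient_seq G gs) x = 1))"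

definition D_sequence :: "('a, 'b) monoid_scheme \<Rightarrow> 'a list \<Rightarrow> bool" where
  "D_sequence G gs \<longleftrightarrow>
     length gs = 2 * order G \<and> set gs \<subseteq> carrier G \<and> gs ! 0 = \<one>\<^bsub>G\<^esub> \<and>
     (\<forall>x\<in>carrier G. count_list gs x = 2 \<and> count_list (quotient_seq G gs) x = 2)"

definition cyclic_D_sequence :: "('a, 'b) monoid_scheme \<Rightarrow> 'a list \<Rightarrow> bool" where
  "cyclic_D_sequence G gs \<longleftrightarrow> D_sequence G gs \<and> gs ! (2 * order G - 1) = \<one>\<^bsub>G\<^esub>"

abbreviation Z2_power :: "nat \<Rightarrow> (nat \<Rightarrow> int) monoid" where
  "Z2_power k \<equiv> product_group {..<k} (\<lambda>_. integer_mod_group 2)"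

end

theory Submission
  imports Defs "HOL-Algebra.Algebraic_Closure_Type" "HOL-Library.Z2"
begin

text \<open>
  Two independent constructions combine to give the theorem.

  The first (\<open>cyclic_D_sequence_DirProd\<close>) reduces it to the factor \<open>A = (\<int>/2)\<^sup>k\<close>. Let
  \<open>g\<^sub>0, \<dots>, g\<^sub>n\<^sub>-\<^sub>1\<close> be a sequencing of \<open>N\<close> and \<open>h\<close> a cyclic D-sequence of \<open>A\<close>. The first coordinate
  walks \<open>2 |A|\<close> times through the sequencing, alternately forwards and backwards. The
  second coordinate alternates, during pass \<open>r\<close>, between \<open>h\<^sub>r\<close> and \<open>h\<^sub>r\<^sub>-\<^sub>1\<close>. As every element of \<open>A\<close> is
  its own inverse, all quotients met in pass \<open>r\<close>, including the one that enters the pass, have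
  second coordinate \<open>h\<^sub>r\<^sub>-\<^sub>1\<^sup>-\<^sup>1 h\<^sub>r\<close>, and their first coordinates run once through \<open>N\<close>. Hence each
  pair occurs twice as a quotient, because each element of \<open>A\<close> occurs twice as a quotient of \<open>h\<close>.
  Since \<open>n\<close> is odd, reversing a pass does not change the parity of the position of a given \<open>x\<close> within
  it. So the second coordinates met at \<open>x\<close> are either all the \<open>h\<^sub>r\<close> or all the \<open>h\<^sub>r\<^sub>-\<^sub>1\<close>, and both
  families cover \<open>A\<close> twice.

  The second (\<open>ex_cyclic_D_sequence\<close>) gives a cyclic D-sequence of the additive group of a field \<open>K\<close>
  with \<open>q = 2\<^sup>k > 2\<close> elements. Let \<open>w\<close> generate the multiplicative group. The powers of \<open>w\<close>
  form a cycle of length \<open>M = q - 1\<close> whose differences \<open>(1 + w) w\<^sup>i\<close> are again all the nonzero elements.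
  Running through the cycle twice, \<open>0\<close> is still to be inserted twice and the
  difference \<open>0\<close> is to be created twice. Starting and ending at \<open>0\<close> gives one difference \<open>0\<close>,
  the empty quotient at index \<open>0\<close>; the other is made by moving one copy of a single power \<open>w\<^sup>j\<close> next to
  its other copy. The remaining differences balance when \<open>(1 + w) w\<^sup>j = 1\<close>, and such a \<open>j\<close>
  exists because \<open>w\<close> is a generator.

  Such a field is found as the set of solutions of \<open>x\<^sup>q = x\<close> in an algebraic closure of the field
  with two elements, and its additive group is isomorphic to \<open>(\<int>/2)\<^sup>k\<close>, because any
  group of order \<open>2\<^sup>k\<close> and exponent two is. The cases \<open>k \<le> 1\<close> are settled by explicit sequences.
\<close>

(* The order of a group would otherwise be shadowed by the order of a root of a polynomial. *)
hide_const (open) Polynomial.order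

section \<open>Counting in sequences, and transport along isomorphisms\<close>

lemma count_list_eq_card: "count_list gs x = card {p. p < length gs \<and> gs ! p = x}"
  by (simp only: count_list_eq_length_filter length_filter_conv_card eq_commute[of x])

lemma length_quotient_seq [simp]: "length (quotient_seq G gs) = length gs"
  by (simp add: quotient_seq_def)

lemma nth_quotient_seq:
  "p < length gs \<Longrightarrow> quotient_seq G gs ! p =
     (if p = 0 then \<one>\<^bsub>G\<^esub> else inv\<^bsub>G\<^esub> (gs ! (p - 1)) \<otimes>\<^bsub>G\<^esub> gs ! p)"
  by (simp add: quotient_seq_def)

lemma ex1_index_of_count_list:
  assumes "count_list gs x = 1"
  shows "\<exists>!p. p < length gs \<and> gs ! p = x"
proof -
  obtain p where "{p. p < length gs \<and> gs ! p = x} = {p}"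
    using assms unfolding count_list_eq_card by (rule card_1_singletonE)
  then have "p' < length gs \<and> gs ! p' = x \<longleftrightarrow> p' = p" for p' by (simp add: set_eq_iff)
  then show ?thesis by simp
qed

text \<open>A walk of length \<open>M * n\<close> is cut into \<open>M\<close> passes of length \<open>n\<close>. If a property \<open>P\<close> singles out one
  position in each pass, then counting positions with \<open>P\<close> and a further property amounts to counting
  passes.\<close>

lemma card_one_per_block:
  fixes n M :: nat
  assumes "n > 0"
    and unique: "\<And>r. r < M \<Longrightarrow> \<exists>!j. j < n \<and> P r j"
    and Q: "\<And>r j. r < M \<Longrightarrow> j < n \<Longrightarrow> P r j \<Longrightarrow> Q r j \<longleftrightarrow> R r"
  shows "card {p. p < M * n \<and> P (p div n) (p mod n) \<and> Q (p div n) (p mod n)} = card {r. r < M \<and> R r}"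
    (is "card ?S = card ?T")
proof -
  have "bij_betw (\<lambda>p. p div n) ?S ?T"
  proof (rule bij_betwI')
    fix p p' assume p: "p \<in> ?S" "p' \<in> ?S"
    have "p = p'" if eq: "p div n = p' div n"
    proof -
      have "p div n < M" using p by (simp add: less_mult_imp_div_less)
      moreover have "P (p div n) (p mod n)" "P (p div n) (p' mod n)" using p eq by auto
      moreover have "p mod n < n" "p' mod n < n" using \<open>n > 0\<close> by auto
      ultimately have "p mod n = p' mod n" using unique by blast
      then show ?thesis using eq by (metis div_mult_mod_eq)
    qed
    then show "(p div n = p' div n) = (p = p')" by blast
  next
    fix p assume "p \<in> ?S"
    then show "p div n \<in> ?T"
      using Q[of "p div n" "p mod n"] \<open>n > 0\<close> by (auto simp: less_mult_imp_div_less)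
  next
    fix r assume r: "r \<in> ?T"
    then obtain j where j: "j < n" "P r j" using unique by blast
    have "r * n + j < Suc r * n" using j by simp
    also have "\<dots> \<le> M * n" using r by (intro mult_le_mono1) auto
    finally have "r * n + j \<in> ?S" using j r Q by simp
    then show "\<exists>p\<in>?S. r = p div n" using j by (intro bexI[of _ "r * n + j"]) auto
  qed
  then show ?thesis by (rule bij_betw_same_card)
qed

lemma cyclic_D_sequence_iso:
  assumes "group G" "group H" and iso: "\<phi> \<in> iso G H" and D: "cyclic_D_sequence G gs"
  shows "cyclic_D_sequence H (map \<phi> gs)"
proof -
  interpret G: group G by fact
  interpret H: group H by fact
  interpret group_hom G H \<phi>
    using iso by unfold_locales (simp add: iso_def)
  have inj: "inj_on \<phi> (carrier G)" and img: "\<phi> ` carrier G = carrier H"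
    using iso by (auto simp: iso_def bij_betw_def)
  have order: "order H = order G"
    unfolding Coset.order_def img[symmetric] by (simp add: card_image inj)
  have sub: "set gs \<subseteq> carrier G" and len: "length gs = 2 * order G"
    and counts: "\<And>x. x \<in> carrier G \<Longrightarrow> count_list gs x = 2 \<and> count_list (quotient_seq G gs) x = 2"
    and ends: "gs ! 0 = \<one>\<^bsub>G\<^esub>" "gs ! (2 * order G - 1) = \<one>\<^bsub>G\<^esub>"
    using D by (auto simp: cyclic_D_sequence_def D_sequence_def)
  have nth: "gs ! i \<in> carrier G" if "i < length gs" for i
    using sub that by (meson nth_mem subsetD)
  have quot_sub: "set (quotient_seq G gs) \<subseteq> carrier G"
    using nth by (auto simp: quotient_seq_def)
  have quot: "quotient_seq H (map \<phi> gs) = map \<phi> (quotient_seq G gs)"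
    by (rule nth_equalityI) (auto simp: nth_quotient_seq nth)
  have count_map: "count_list (map \<phi> xs) (\<phi> x) = count_list xs x"
    if "set xs \<subseteq> carrier G" "x \<in> carrier G" "count_list xs x = 2" for xs x
  proof -
    have "x \<in> set xs" using that(3) by (metis count_notin zero_neq_numeral)
    then show ?thesis
      using that inj by (intro count_list_inj_map) (auto intro: inj_on_subset)
  qed
  have pos: "0 < length gs"
    using counts[OF G.one_closed] by (cases gs) auto
  then show ?thesis
    unfolding cyclic_D_sequence_def D_sequence_def order quot img[symmetric]
    using len sub ends counts count_map[OF sub] count_map[OF quot_sub] by auto
qed

section \<open>The product with a sequenceable group of odd order\<close>

lemma bij_betw_cyclic_pred: "bij_betw (\<lambda>r. if r = 0 then m - 1 else r - 1) {..<m} {..<m::nat}"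
  by (rule bij_betw_byWitness[where f' = "\<lambda>r. if r = m - 1 then 0 else r + 1"]) auto

text \<open>The truncated predecessor \<open>0 - 1 = 0\<close> acts as the cyclic one here, because a cyclic
  D-sequence has equal first and last entries.\<close>

lemma cyclic_D_sequence_shifted_count:
  assumes "group A" "cyclic_D_sequence A h" "a \<in> carrier A"
  shows "card {r. r < 2 * order A \<and> h ! (r - 1) = a} = 2"
proof -
  let ?m = "2 * order A"
  have ends: "h ! 0 = h ! (?m - 1)" and count: "count_list h a = 2" and len: "length h = ?m"
    using assms by (auto simp: cyclic_D_sequence_def D_sequence_def)
  have "bij_betw (\<lambda>r. if r = 0 then ?m - 1 else r - 1) {r \<in> {..<?m}. h ! (r - 1) = a} {r \<in> {..<?m}. h ! r = a}"
    by (intro bij_betw_Collect[OF bij_betw_cyclic_pred]) (use ends in auto)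
  then have "card {r \<in> {..<?m}. h ! (r - 1) = a} = card {r \<in> {..<?m}. h ! r = a}"
    by (rule bij_betw_same_card)
  then show ?thesis
    using count len by (simp add: count_list_eq_card)
qed

theorem cyclic_D_sequence_DirProd:
  assumes "group N" "odd (order N)" "sequenceable N"
    and "group A" "finite (carrier A)" and exp2: "\<And>a. a \<in> carrier A \<Longrightarrow> a \<otimes>\<^bsub>A\<^esub> a = \<one>\<^bsub>A\<^esub>"
    and D: "cyclic_D_sequence A h"
  shows "\<exists>gs. cyclic_D_sequence (N \<times>\<times> A) gs"
proof -
  interpret N: group N by fact
  interpret A: group A by fact
  define n where "n = order N"
  define m where "m = 2 * order A"
  obtain g where g: "length g = n" "set g \<subseteq> carrier N" "g ! 0 = \<one>\<^bsub>N\<^esub>"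
    and g_count: "\<And>x. x \<in> carrier N \<Longrightarrow> count_list g x = 1 \<and> count_list (quotient_seq N g) x = 1"
    using \<open>sequenceable N\<close> unfolding sequenceable_def n_def by blast
  have h: "length h = m" "set h \<subseteq> carrier A" "h ! 0 = \<one>\<^bsub>A\<^esub>" "h ! (m - 1) = \<one>\<^bsub>A\<^esub>"
    and h_count: "\<And>a. a \<in> carrier A \<Longrightarrow> count_list h a = 2 \<and> count_list (quotient_seq A h) a = 2"
    using D by (auto simp: cyclic_D_sequence_def D_sequence_def m_def)
  have n: "n > 0" "odd n" using \<open>odd (order N)\<close> by (auto simp: n_def odd_pos)
  have m: "m > 0" "even m" using A.order_gt_0_iff_finite \<open>finite (carrier A)\<close> by (auto simp: m_def)
  have g_in: "g ! i \<in> carrier N" if "i < n" for i using g that by (meson nth_mem subsetD)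
  have h_in: "h ! i \<in> carrier A" if "i < m" for i using h that by (meson nth_mem subsetD)
  define q where "q = quotient_seq N g"
  define d where "d = quotient_seq A h"
  have q_0: "q ! 0 = \<one>\<^bsub>N\<^esub>" using g n by (simp add: q_def nth_quotient_seq)
  have q_step: "q ! i = inv\<^bsub>N\<^esub> (g ! (i - 1)) \<otimes>\<^bsub>N\<^esub> g ! i" if "0 < i" "i < n" for i
    using that g by (simp add: q_def nth_quotient_seq)
  have q_in: "q ! i \<in> carrier N" if "i < n" for i
    using that q_0 q_step g_in by (cases "i = 0") auto
  have A_inv: "inv\<^bsub>A\<^esub> a = a" if "a \<in> carrier A" for a
    using exp2[OF that] that by (simp add: A.inv_equality)
  have A_comm: "a \<otimes>\<^bsub>A\<^esub> b = b \<otimes>\<^bsub>A\<^esub> a" if "a \<in> carrier A" "b \<in> carrier A" for a b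
    using A.inv_mult_group[OF that] A_inv that by simp
  have d_eq: "d ! r = h ! (r - 1) \<otimes>\<^bsub>A\<^esub> h ! r" if "r < m" for r
    using that h h_in A_inv exp2 by (auto simp: d_def nth_quotient_seq)
  have g_index: "\<exists>!i. i < n \<and> g ! i = x" if "x \<in> carrier N" for x
    using ex1_index_of_count_list[of g x] g_count that g by simp
  have q_index: "\<exists>!i. i < n \<and> q ! i = x" if "x \<in> carrier N" for x
    using ex1_index_of_count_list[of q x] g_count that g by (simp add: q_def)

  have block: "(r * n + j) div n = r" "(r * n + j) mod n = j" if "j < n" for r j :: nat
    using that by auto

  \<comment> \<open>Coordinates at place \<open>j\<close> of pass \<open>r\<close>, and the first coordinate of the quotient taken there.
    For \<open>r = 0\<close> the truncated \<open>r - 1\<close> is harmless: \<open>h ! 0\<close> is also the last entry of \<open>h\<close>.\<close>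
  define gN where "gN r j = g ! (if even r then j else n - 1 - j)" for r j :: nat
  define hA where "hA r j = h ! (if even j then r else r - 1)" for r j :: nat
  define f where "f p = (gN (p div n) (p mod n), hA (p div n) (p mod n))" for p
  define qN where "qN r j = (if j = 0 then \<one>\<^bsub>N\<^esub> else if even r then q ! j else inv\<^bsub>N\<^esub> (q ! (n - j)))" for r j :: nat
  define gs where "gs = map f [0..<m * n]"

  have gN_in: "gN r j \<in> carrier N" if "j < n" for r j
    using that g_in by (auto simp: gN_def)
  have hA_in: "hA r j \<in> carrier A" if "r < m" for r j
    using that h_in by (auto simp: hA_def)
  have f_in: "f p \<in> carrier (N \<times>\<times> A)" if "p < m * n" for p
    using that n gN_in hA_in by (auto simp: f_def less_mult_imp_div_less)

  have gN_index: "\<exists>!j. j < n \<and> gN r j = x" if x: "x \<in> carrier N" for r x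
  proof (cases "even r")
    case True
    then show ?thesis using g_index[OF x] by (simp add: gN_def)
  next
    case False
    obtain i where i: "i < n" "g ! i = x" "\<And>i'. i' < n \<Longrightarrow> g ! i' = x \<Longrightarrow> i' = i"
      using g_index[OF x] by blast
    show ?thesis
    proof (rule ex1I[of _ "n - 1 - i"])
      fix j assume "j < n \<and> gN r j = x"
      then have "n - 1 - j = i" "j < n" using False i(3)[of "n - 1 - j"] by (simp_all add: gN_def)
      then show "j = n - 1 - i" by linarith
    qed (use i(1,2) False in \<open>simp add: gN_def\<close>)
  qed
  have qN_index: "\<exists>!j. j < n \<and> qN r j = x" if x: "x \<in> carrier N" for r x
  proof (cases "even r")
    case True
    then have "qN r j = q ! j" for j using q_0 by (simp add: qN_def)
    then show ?thesis using q_index[OF x] by simp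
  next
    case False
    obtain i where i: "i < n" "q ! i = inv\<^bsub>N\<^esub> x" "\<And>i'. i' < n \<Longrightarrow> q ! i' = inv\<^bsub>N\<^esub> x \<Longrightarrow> i' = i"
      using q_index[of "inv\<^bsub>N\<^esub> x"] x by blast
    show ?thesis
    proof (rule ex1I[of _ "if i = 0 then 0 else n - i"])
      show "(if i = 0 then 0 else n - i) < n \<and> qN r (if i = 0 then 0 else n - i) = x"
      proof (cases "i = 0")
        case True
        then have "x = \<one>\<^bsub>N\<^esub>" using i(2) q_0 x N.inv_eq_1_iff by metis
        then show ?thesis using True n by (simp add: qN_def)
      next
        case False
        then show ?thesis using i(1,2) \<open>odd r\<close> x by (simp add: qN_def)
      qed
    next
      fix j assume j: "j < n \<and> qN r j = x"
      show "j = (if i = 0 then 0 else n - i)"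
      proof (cases "j = 0")
        case True
        then have "x = \<one>\<^bsub>N\<^esub>" using j by (simp add: qN_def)
        then have "i = 0" using i(3)[of 0] n q_0 by simp
        then show ?thesis using True by simp
      next
        case False
        then have "x = inv\<^bsub>N\<^esub> (q ! (n - j))" using j \<open>odd r\<close> by (simp add: qN_def)
        moreover have "n - j < n" using False n by simp
        ultimately have "n - j = i" using i(3)[of "n - j"] q_in[of "n - j"] by simp
        then show ?thesis using False j by auto
      qed
    qed
  qed

  have quotient: "quotient_seq (N \<times>\<times> A) gs ! p = (qN (p div n) (p mod n), d ! (p div n))"
    if p: "p < m * n" for p
  proof -
    define r where "r = p div n"
    define j where "j = p mod n"
    have r: "r < m" and j: "j < n" using p n by (auto simp: r_def j_def less_mult_imp_div_less)
    have p_eq: "p = r * n + j" by (simp add: r_def j_def)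
    consider "p = 0" | "j = 0" "r > 0" | "j > 0" using p_eq by fastforce
    then have "quotient_seq (N \<times>\<times> A) gs ! p = (qN r j, d ! r)"
    proof cases
      case 1
      then show ?thesis using p_eq n h m p by (auto simp: qN_def gs_def nth_quotient_seq d_def)
    next
      \<comment> \<open>Entering a new pass: the first coordinate rests at the turning point, and the
        previous pass has left the second coordinate at \<open>h ! (r - 1)\<close>, as \<open>n - 1\<close> is even.\<close>
      case 2
      have p1: "p - 1 = (r - 1) * n + (n - 1)"
        using 2 p_eq n by (cases r) auto
      have dm: "(p - 1) div n = r - 1" "(p - 1) mod n = n - 1"
        unfolding p1 using n by (simp_all only: block diff_less zero_less_one)
      have "f (p - 1) = (gN r 0, h ! (r - 1))"
        unfolding f_def dm using 2 n by (simp add: gN_def hA_def)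
      moreover have "f p = (gN r 0, h ! r)"
        using 2 by (simp add: f_def r_def[symmetric] j_def[symmetric] hA_def)
      moreover have "p > 0" using 2 p_eq n by simp
      ultimately show ?thesis
        using p r 2 n \<open>group N\<close> \<open>group A\<close> by (simp add: gs_def nth_quotient_seq inv_DirProd h_in gN_in A_inv d_eq qN_def)
    next
      case 3
      have p1: "p - 1 = r * n + (j - 1)" using 3 p_eq by simp
      have dm: "(p - 1) div n = r" "(p - 1) mod n = j - 1"
        unfolding p1 using j by (simp_all only: block less_imp_diff_less)
      have "f (p - 1) = (gN r (j - 1), hA r (j - 1))"
        by (simp only: f_def dm)
      moreover have "f p = (gN r j, hA r j)"
        by (simp add: f_def r_def j_def)
      moreover have "p > 0" using 3 p_eq by simp
      moreover have "inv\<^bsub>N\<^esub> (gN r (j - 1)) \<otimes>\<^bsub>N\<^esub> gN r j = qN r j"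
      proof (cases "even r")
        case True
        then show ?thesis using 3 j by (simp add: gN_def qN_def q_step)
      next
        case False
        have "n - 1 - (j - 1) = n - j" "n - 1 - j = n - j - 1" using 3 j by auto
        then show ?thesis using 3 j False g_in[of "n - j"] g_in[of "n - j - 1"]
          by (simp add: gN_def qN_def q_step N.inv_mult_group)
      qed
      moreover have "inv\<^bsub>A\<^esub> (hA r (j - 1)) \<otimes>\<^bsub>A\<^esub> hA r j = d ! r"
        using r 3 h_in[of r] h_in[of "r - 1"] A_comm[of "h ! r" "h ! (r - 1)"]
        by (auto simp: d_eq A_inv hA_def)
      ultimately show ?thesis
        using p r j \<open>group N\<close> \<open>group A\<close> by (simp add: gs_def nth_quotient_seq inv_DirProd hA_in gN_in)
    qed
    then show ?thesis by (simp add: r_def j_def)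
  qed

  have order: "order (N \<times>\<times> A) = n * order A"
    by (simp add: Coset.order_def n_def DirProd_def card_cartesian_product)
  have len: "length gs = m * n" by (simp add: gs_def)
  have gs_count: "count_list gs z = 2" if z: "z \<in> carrier (N \<times>\<times> A)" for z
  proof -
    obtain x a where xa: "z = (x, a)" "x \<in> carrier N" "a \<in> carrier A" using z by (auto simp: DirProd_def)
    obtain i where i: "i < n" "g ! i = x" "\<And>i'. i' < n \<Longrightarrow> g ! i' = x \<Longrightarrow> i' = i"
      using g_index[OF xa(2)] by blast
    \<comment> \<open>The place of \<open>x\<close> in a pass is \<open>i\<close> or \<open>n - 1 - i\<close>, of equal parity as \<open>n\<close> is odd.\<close>
    have parity: "even j \<longleftrightarrow> even i" if "j < n" "gN r j = x" for r j
      using that i(3)[of "if even r then j else n - 1 - j"] n by (auto simp: gN_def)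
    have "count_list gs z = card {p. p < m * n \<and> gN (p div n) (p mod n) = x \<and> hA (p div n) (p mod n) = a}"
      unfolding count_list_eq_card len by (rule arg_cong[of _ _ card]) (auto simp: gs_def f_def xa)
    also have "\<dots> = card {r. r < m \<and> h ! (if even i then r else r - 1) = a}"
      using parity by (intro card_one_per_block) (auto simp: n gN_index xa hA_def)
    also have "\<dots> = 2"
      using h_count[OF xa(3)] cyclic_D_sequence_shifted_count[OF \<open>group A\<close> D xa(3)] h(1)
      by (cases "even i") (simp_all add: count_list_eq_card m_def)
    finally show ?thesis .
  qed
  have quot_count: "count_list (quotient_seq (N \<times>\<times> A) gs) z = 2" if z: "z \<in> carrier (N \<times>\<times> A)" for z
  proof -
    obtain x a where xa: "z = (x, a)" "x \<in> carrier N" "a \<in> carrier A" using z by (auto simp: DirProd_def)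
    have "count_list (quotient_seq (N \<times>\<times> A) gs) z =
        card {p. p < m * n \<and> qN (p div n) (p mod n) = x \<and> d ! (p div n) = a}"
      unfolding count_list_eq_card length_quotient_seq len
      by (rule arg_cong[of _ _ card]) (auto simp: quotient xa)
    also have "\<dots> = card {r. r < m \<and> d ! r = a}"
      by (intro card_one_per_block) (auto simp: n qN_index xa)
    also have "\<dots> = 2"
      using h_count[OF xa(3)] h(1) by (simp add: count_list_eq_card d_def)
    finally show ?thesis .
  qed
  have last: "f (m * n - 1) = \<one>\<^bsub>N \<times>\<times> A\<^esub>"
  proof -
    have p1: "m * n - 1 = (m - 1) * n + (n - 1)"
      using m n by (cases m) auto
    have "(m * n - 1) div n = m - 1" "(m * n - 1) mod n = n - 1"
      unfolding p1 using n by (simp_all only: block diff_less zero_less_one)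
    then have "f (m * n - 1) = (gN (m - 1) (n - 1), hA (m - 1) (n - 1))"
      by (simp only: f_def)
    then show ?thesis using n m h g by (simp add: gN_def hA_def)
  qed
  have first: "gs ! 0 = \<one>\<^bsub>N \<times>\<times> A\<^esub>"
    using n m g h by (simp add: gs_def f_def gN_def hA_def)
  have length: "m * n = 2 * order (N \<times>\<times> A)"
    by (simp add: order m_def)
  have nth_last: "gs ! (m * n - 1) = \<one>\<^bsub>N \<times>\<times> A\<^esub>"
    using n m last by (simp add: gs_def)
  have subset: "set gs \<subseteq> carrier (N \<times>\<times> A)"
    using f_in by (auto simp only: gs_def set_map set_upt atLeastLessThan_iff)
  have "cyclic_D_sequence (N \<times>\<times> A) gs"
    unfolding cyclic_D_sequence_def D_sequence_def length[symmetric]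
    by (intro conjI ballI len subset first nth_last gs_count quot_count)
  then show ?thesis by blast
qed

section \<open>Cyclic D-sequences in finite fields of characteristic two\<close>

definition additive_group :: "'f::monoid_add set \<Rightarrow> 'f monoid" where
  "additive_group K = \<lparr>carrier = K, monoid.mult = (+), one = 0\<rparr>"

lemma additive_group_simps [simp]:
  "carrier (additive_group K) = K" "x \<otimes>\<^bsub>additive_group K\<^esub> y = x + y" "\<one>\<^bsub>additive_group K\<^esub> = 0"
  by (simp_all add: additive_group_def)

text \<open>The quotients of a sequence in an additive group of exponent two, where \<open>a + b = b - a\<close>. The first
  argument is the entry that precedes the list.\<close>

fun steps :: "'f::plus \<Rightarrow> 'f list \<Rightarrow> 'f list" where
  "steps a [] = []"
| "steps a (b # bs) = (a + b) # steps b bs"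

lemma length_steps [simp]: "length (steps a bs) = length bs"
  by (induction bs arbitrary: a) auto

lemma nth_steps: "i < length bs \<Longrightarrow> steps a bs ! i = (a # bs) ! i + bs ! i"
proof (induction bs arbitrary: a i)
  case (Cons b bs)
  then show ?case by (cases i) auto
qed simp

lemma steps_append: "steps a (bs @ cs) = steps a bs @ steps (last (a # bs)) cs"
  by (induction bs arbitrary: a) auto

text \<open>The factor \<open>1 + w\<close> comes from \<open>w\<^sup>i + w\<^sup>i\<^sup>+\<^sup>1 = (1 + w) w\<^sup>i\<close>, so the steps between consecutive powers
  are again proportional to powers.\<close>

lemma steps_powers:
  fixes w :: "'f::comm_semiring_1"
  shows "steps (w ^ a) (map ((^) w) [Suc a..<a + Suc l]) = map (\<lambda>i. (1 + w) * w ^ i) [a..<a + l]"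
proof (induction l)
  case (Suc l)
  have last: "last (w ^ a # map ((^) w) [Suc a..<a + Suc l]) = w ^ (a + l)"
    by (cases l) auto
  have split: "map ((^) w) [Suc a..<a + Suc (Suc l)] = map ((^) w) [Suc a..<a + Suc l] @ [w ^ (a + Suc l)]"
    by simp
  show ?case
    unfolding split steps_append last Suc by (simp add: distrib_right)
qed simp

lemma steps_powers_block:
  fixes w :: "'f::comm_semiring_1"
  assumes "a < b"
  shows "steps y (map ((^) w) [a..<b] @ zs) =
    (y + w ^ a) # map (\<lambda>i. (1 + w) * w ^ i) [a..<b - 1] @ steps (w ^ (b - 1)) zs"
proof -
  have "last (y # map ((^) w) [a..<b]) = w ^ (b - 1)"
    using assms by (simp add: last_map)
  moreover have "map ((^) w) [a..<b] = w ^ a # map ((^) w) [Suc a..<b]"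
    using assms by (simp add: upt_conv_Cons)
  moreover have "steps (w ^ a) (map ((^) w) [Suc a..<b]) = map (\<lambda>i. (1 + w) * w ^ i) [a..<b - 1]"
    using steps_powers[of w a "b - Suc a"] assms by (simp add: Suc_diff_Suc)
  ultimately show ?thesis
    by (simp add: steps_append)
qed

locale char_2_subgroup =
  fixes K :: "'f::comm_ring_1 set"
  assumes char: "(1::'f) + 1 = 0"
    and finite: "finite K" and zero: "0 \<in> K" and add: "\<And>x y. x \<in> K \<Longrightarrow> y \<in> K \<Longrightarrow> x + y \<in> K"
begin

lemma add_self [simp]: "x + x = (0::'f)"
  using char by (metis distrib_left mult_1_right mult_zero_right)

lemma two: "(2::'f) = 0"
  using char by (simp only: one_add_one)

lemma group_additive: "group (additive_group K)"
  by (rule groupI) (auto simp: zero add add.assoc intro: add_self)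

lemma quotient_seq_additive:
  assumes "set xs \<subseteq> K"
  shows "quotient_seq (additive_group K) (0 # xs) = 0 # steps 0 xs"
proof (rule nth_equalityI)
  fix i assume i: "i < length (quotient_seq (additive_group K) (0 # xs))"
  interpret G: group "additive_group K" by (rule group_additive)
  have inv: "inv\<^bsub>additive_group K\<^esub> x = x" if "x \<in> K" for x
    using that by (intro G.inv_equality) auto
  show "quotient_seq (additive_group K) (0 # xs) ! i = (0 # steps 0 xs) ! i"
  proof (cases i)
    case (Suc l)
    then have "(0 # xs) ! l \<in> K"
      using i assms zero by (cases l) auto
    then show ?thesis using i Suc by (simp add: nth_quotient_seq nth_steps inv)
  qed (simp add: nth_quotient_seq)
qed simp

lemma cyclic_D_sequence_additiveI:
  assumes "set xs \<subseteq> K" "length (0 # xs) = 2 * card K" "last xs = 0"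
    and "\<And>x. x \<in> K \<Longrightarrow> count (mset (0 # xs)) x = 2"
    and "\<And>x. x \<in> K \<Longrightarrow> count (mset (0 # steps 0 xs)) x = 2"
  shows "cyclic_D_sequence (additive_group K) (0 # xs)"
proof -
  have "length xs = 2 * card K - 1" "xs \<noteq> []" using assms(2) by (cases xs; simp; presburger)+
  then have "(0 # xs) ! (2 * card K - 1) = 0"
    using assms(3) by (simp add: last_conv_nth nth_Cons')
  then show ?thesis
    using assms zero
    by (simp add: cyclic_D_sequence_def D_sequence_def Coset.order_def quotient_seq_additive flip: count_mset)
qed

end

locale char_2_subfield = char_2_subgroup K for K :: "'f::field set" +
  assumes one: "1 \<in> K" and mult: "\<And>x y. x \<in> K \<Longrightarrow> y \<in> K \<Longrightarrow> x * y \<in> K"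
    and inverse: "\<And>x. x \<in> K \<Longrightarrow> inverse x \<in> K"
begin

lemma image_mset_mult:
  assumes "c \<in> K - {0}"
  shows "image_mset ((*) c) (mset_set (K - {0})) = mset_set (K - {0})"
proof -
  have "bij_betw ((*) c) (K - {0}) (K - {0})"
    using assms by (intro bij_betw_byWitness[where f' = "(*) (inverse c)"]) (auto simp: mult inverse)
  then show ?thesis by (simp add: bij_betw_def image_mset_mset_set)
qed

text \<open>With \<open>M = card K - 1\<close> and \<open>(1 + w) w\<^sup>j = 1\<close>, the sequence is
  \<open>0, w\<^sup>0, \<dots>, w\<^sup>j, w\<^sup>j, \<dots>, w\<^sup>M\<^sup>-\<^sup>1, w\<^sup>0, \<dots>, w\<^sup>j\<^sup>-\<^sup>1, w\<^sup>j\<^sup>+\<^sup>1, \<dots>, w\<^sup>M\<^sup>-\<^sup>1, 0\<close>.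
  Write \<open>f i = (1 + w) w\<^sup>i\<close>. Compared with two full cycles of powers, the steps \<open>f (j - 1)\<close> and \<open>f j\<close>
  around the skipped power and the step \<open>f (M - 1)\<close> that closes the second cycle are missing. They are
  replaced by the first step \<open>w\<^sup>0 = 1 = f j\<close>, the last step \<open>w\<^sup>M\<^sup>-\<^sup>1 = f (j - 1)\<close>, and the
  step over the gap, which is \<open>f (j - 1) + f j = w\<^sup>M\<^sup>-\<^sup>1 + 1 = f (M - 1)\<close>.\<close>

lemma ex_cyclic_D_sequence:
  assumes card: "card K > 2"
    and w_order: "w ^ (card K - 1) = 1" and powers: "bij_betw ((^) w) {..<card K - 1} (K - {0})"
  shows "\<exists>gs. cyclic_D_sequence (additive_group K) gs"
proof -
  define M where "M = card K - 1"
  have M: "M \<ge> 2" "w ^ M = 1" and bij: "bij_betw ((^) w) {..<M} (K - {0})"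
    using card w_order powers by (simp_all add: M_def)
  have inj: "w ^ i = w ^ l \<longleftrightarrow> i = l" if "i < M" "l < M" for i l
    using bij that by (auto simp: bij_betw_def inj_on_def)
  have in_K: "w ^ i \<in> K - {0}" if "i < M" for i
    using bij that by (auto simp: bij_betw_def)
  have w: "w \<in> K" "w \<noteq> 0" "w \<noteq> 1"
    using in_K[of 1] inj[of 1 0] M(1) by auto
  have "1 + w \<noteq> 0"
    using w(3) add_self[of w] by (metis add_right_cancel)
  then have c: "1 + w \<in> K - {0}" using w one add by auto
  define f where "f i = (1 + w) * w ^ i" for i :: nat
  have mset_powers: "mset (map ((^) w) [0..<M]) = mset_set (K - {0})"
    using bij by (simp add: bij_betw_def image_mset_mset_set atLeast0LessThan)
  have "mset (map f [0..<M]) = image_mset ((*) (1 + w)) (mset (map ((^) w) [0..<M]))"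
    by (simp add: f_def[abs_def] image_mset.compositionality comp_def)
  then have mset_f: "mset (map f [0..<M]) = mset_set (K - {0})"
    using image_mset_mult[OF c] by (simp only: mset_powers)

  obtain j where j: "j < M" "w ^ j = inverse (1 + w)"
  proof -
    have "inverse (1 + w) \<in> K - {0}" using c inverse by auto
    then have "inverse (1 + w) \<in> (^) w ` {..<M}" using bij by (simp add: bij_betw_def)
    then show ?thesis using that by auto
  qed
  have fj: "f j = 1" using c j(2) by (simp add: f_def)
  have "w ^ (M - 1) * w = 1" using M power_minus_mult[of M w] by simp
  then have w_last: "f (M - 1) = w ^ (M - 1) + 1" by (simp add: f_def distrib_right mult.commute)
  \<comment> \<open>The moved power is neither the first nor the last of the cycle, so it has both neighbours.\<close>
  have "j \<noteq> 0" using fj w by (intro notI) (simp add: f_def)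
  have "j \<noteq> M - 1" using fj w_last w by auto
  then have j': "0 < j" "j + 1 < M" using j \<open>j \<noteq> 0\<close> by auto
  have "w ^ j = w ^ (j - 1) * w" using j'(1) power_minus_mult[of j w] by simp
  then have f_pred: "f (j - 1) * w = 1" using fj by (simp add: f_def mult.assoc)
  then have "f (j - 1) = w ^ (M - 1)"
    using \<open>w ^ (M - 1) * w = 1\<close> w(2) by (metis mult_right_cancel)
  have skip: "w ^ (j - 1) + w ^ (j + 1) = f (M - 1)"
  proof -
    have "f (j - 1) + f j = w ^ (j - 1) + w ^ (j + 1) + (w ^ j + w ^ j)"
      using \<open>w ^ j = w ^ (j - 1) * w\<close> two by (simp add: f_def algebra_simps)
    then show ?thesis
      using \<open>f (j - 1) = w ^ (M - 1)\<close> fj w_last by simp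
  qed

  define xs where "xs = map ((^) w) [0..<j + 1] @ map ((^) w) [j..<M] @ map ((^) w) [0..<j] @ map ((^) w) [j + 1..<M] @ [0]"
  have steps: "steps 0 xs = f j # map f [0..<j] @ 0 # map f [j..<M - 1] @ f (M - 1) # map f [0..<j - 1]
       @ f (M - 1) # map f [j + 1..<M - 1] @ [f (j - 1)]"
    unfolding xs_def
    using j' w_last skip fj \<open>f (j - 1) = w ^ (M - 1)\<close>
    by (simp add: steps_powers_block f_def[symmetric] del: upt_Suc)
  have split: "mset (map h [0..<i]) + mset (map h [i..<l]) = mset (map h [0..<l])"
    if "i \<le> l" for h :: "nat \<Rightarrow> 'f" and i l
  proof -
    have "[0..<l] = [0..<i] @ [i..<l]"
      using that upt_add_eq_append[of 0 i "l - i"] by simp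
    then show ?thesis by (simp only: map_append mset_append)
  qed
  have snoc: "mset (map f [i..<l]) = mset (map f [i..<l - 1]) + {#f (l - 1)#}" if "i < l" for i l
    using that by (cases l) auto
  have mset_xs: "mset xs = mset_set (K - {0}) + mset_set (K - {0}) + {#0#}"
  proof -
    have "mset xs = (mset (map ((^) w) [0..<j + 1]) + mset (map ((^) w) [j + 1..<M])) +
        (mset (map ((^) w) [0..<j]) + mset (map ((^) w) [j..<M])) + {#0#}"
      unfolding xs_def mset_append by (simp only: ac_simps mset.simps)
    then show ?thesis
      using split[of "j + 1" M "(^) w"] split[of j M "(^) w"] j' by (simp only: mset_powers less_imp_le j(1))
  qed
  have mset_steps: "mset (steps 0 xs) = mset_set (K - {0}) + mset_set (K - {0}) + {#0#}"
  proof -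
    have "mset (steps 0 xs) =
        (((mset (map f [0..<j - 1]) + {#f (j - 1)#}) + {#f j#}) + (mset (map f [j + 1..<M - 1]) + {#f (M - 1)#})) +
        (mset (map f [0..<j]) + (mset (map f [j..<M - 1]) + {#f (M - 1)#})) + {#0#}"
      unfolding steps by simp
    also have "\<dots> = (mset (map f [0..<j + 1]) + mset (map f [j + 1..<M])) +
        (mset (map f [0..<j]) + mset (map f [j..<M])) + {#0#}"
      using snoc[of 0 j] snoc[of 0 "j + 1"] snoc[of "j + 1" M] snoc[of j M] j j' by simp
    also have "\<dots> = mset_set (K - {0}) + mset_set (K - {0}) + {#0#}"
      using split[of "j + 1" M f] split[of j M f] j' by (simp only: mset_f less_imp_le j(1))
    finally show ?thesis .
  qed
  have "cyclic_D_sequence (additive_group K) (0 # xs)"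
  proof (rule cyclic_D_sequence_additiveI)
    have "set xs = set_mset (mset xs)" by simp
    then show "set xs \<subseteq> K" unfolding mset_xs using finite zero by auto
    show "last xs = 0" by (simp add: xs_def)
    show "length (0 # xs) = 2 * card K"
      using j' card by (simp add: xs_def M_def)
    show "count (mset (0 # xs)) x = 2" "count (mset (0 # steps 0 xs)) x = 2" if "x \<in> K" for x
      using that finite by (cases "x = 0"; simp add: mset_xs mset_steps)+
  qed
  then show ?thesis by blast
qed

end

section \<open>Fields with a power of two as number of elements\<close>

text \<open>Over an algebraically closed field \<open>p\<close> splits into linear factors, and a repeated one would make its
  root a root of the derivative too.\<close>

lemma card_roots_separable:
  fixes p :: "'a::alg_closed_field poly"
  assumes "p \<noteq> 0" and sep: "\<And>x. poly p x = 0 \<Longrightarrow> poly (pderiv p) x \<noteq> 0"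
  shows "card {x. poly p x = 0} = degree p"
proof -
  obtain A c where A: "size A = degree p" "p = smult c (\<Prod>x\<in>#A. [:-x, 1:])"
    using alg_closed_imp_factorization[OF \<open>p \<noteq> 0\<close>] by blast
  have "c \<noteq> 0" using \<open>p \<noteq> 0\<close> A(2) by auto
  have "poly p x = c * (\<Prod>y\<in>#A. x - y)" for x
    unfolding A(2) by (simp add: poly_prod_mset)
  then have roots: "{x. poly p x = 0} = set_mset A"
    using \<open>c \<noteq> 0\<close> by auto
  have "count A x = 1" if "x \<in># A" for x
  proof (rule ccontr)
    assume "count A x \<noteq> 1"
    then have "x \<in># A - {#x#}" using that
      by (simp add: in_diff_count count_greater_zero_iff[symmetric] del: count_greater_zero_iff)
    then obtain B where "A - {#x#} = add_mset x B"
      by (blast dest: multi_member_split)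
    then have B: "A = add_mset x (add_mset x B)"
      using insert_DiffM[OF that] by simp
    have "p = [:-x, 1:] * ([:-x, 1:] * smult c (\<Prod>x\<in>#B. [:-x, 1:]))"
      by (simp only: A(2) B image_mset_add_mset prod_mset.add_mset mult_smult_right)
    then obtain s where s: "p = [:-x, 1:] * ([:-x, 1:] * s)" by blast
    have "poly p x = 0" "poly (pderiv p) x = 0"
      unfolding s pderiv_mult by simp_all
    then show False using sep by blast
  qed
  then have "size A = card (set_mset A)"
    by (simp add: size_multiset_overloaded_eq)
  then show ?thesis using roots A by simp
qed

lemma char_2_power_add:
  fixes x y :: "'f::comm_ring_1"
  assumes "(1::'f) + 1 = 0"
  shows "(x + y) ^ 2 ^ k = x ^ 2 ^ k + y ^ 2 ^ k"
proof (induction k)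
  case (Suc k)
  have "(2::'f) = 0" using assms by simp
  then have "(u + v)\<^sup>2 = u\<^sup>2 + v\<^sup>2" for u v :: 'f
    by (simp only: power2_sum) simp
  then show ?case by (simp add: power_mult mult.commute[of 2] Suc power_mult)
qed simp

text \<open>The derivative of \<open>x\<^sup>q - x\<close> with \<open>q = 2\<^sup>k\<close> is the constant \<open>-1\<close> in characteristic two.\<close>

lemma card_frobenius_fixed_points:
  assumes char: "(1::'f::alg_closed_field) + 1 = 0" and "k > 0"
  shows "card {x::'f. x ^ 2 ^ k = x} = 2 ^ k"
proof -
  define p :: "'f poly" where "p = monom 1 (2 ^ k) + [:0, -1:]"
  have "(1::nat) < 2 ^ k" using \<open>k > 0\<close> by (intro one_less_power) auto
  then have deg: "degree p = 2 ^ k"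
    unfolding p_def by (subst degree_add_eq_left) (auto simp: degree_monom_eq)
  have "(2::'f) = 0" using char by simp
  then have "(of_nat (2 ^ k) :: 'f) = 0" using \<open>k > 0\<close> by simp
  then have "pderiv p = -1"
    by (simp add: p_def pderiv_add pderiv_monom pderiv_pCons one_pCons)
  moreover have "{x. poly p x = 0} = {x. x ^ 2 ^ k = x}"
    by (auto simp: p_def poly_monom)
  ultimately show ?thesis
    using card_roots_separable[of p] deg by fastforce
qed

text \<open>The set \<open>K\<close> is a subfield, and the multiplicative group of a finite field is cyclic.\<close>

lemma finite_field_has_generator:
  fixes K :: "'f::field set"
  assumes "finite K" "0 \<in> K" "1 \<in> K"
    and closed: "\<And>x y. x \<in> K \<Longrightarrow> y \<in> K \<Longrightarrow> x + y \<in> K \<and> x * y \<in> K"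
    and uminus: "\<And>x. x \<in> K \<Longrightarrow> - x \<in> K"
    and inverse: "\<And>x. x \<in> K \<Longrightarrow> inverse x \<in> K"
  shows "\<exists>w\<in>K. K - {0} = range (\<lambda>i::nat. w ^ i)"
proof -
  define R :: "'f ring" where "R = \<lparr>carrier = K, monoid.mult = (*), one = 1, ring.zero = 0, add = (+)\<rparr>"
  have "cring R"
  proof (rule cringI)
    show "abelian_group R"
    proof (rule abelian_groupI)
      fix x assume "x \<in> carrier R"
      then have "- x \<in> carrier R" "- x \<oplus>\<^bsub>R\<^esub> x = \<zero>\<^bsub>R\<^esub>"
        using uminus[of x] by (simp_all add: R_def)
      then show "\<exists>y\<in>carrier R. y \<oplus>\<^bsub>R\<^esub> x = \<zero>\<^bsub>R\<^esub>" by blast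
    qed (simp_all add: R_def closed \<open>0 \<in> K\<close> add.assoc add.commute)
    show "comm_monoid R"
      by (rule comm_monoidI) (simp_all add: R_def closed \<open>1 \<in> K\<close> mult.assoc mult.commute)
  qed (simp add: R_def distrib_right)
  moreover have "Units R = K - {0}"
    using assms(2,3) inverse by (force simp: Units_def R_def intro: bexI[of _ "inverse x" for x])
  ultimately interpret R: field R
    by (intro cring.cring_fieldI) (auto simp: R_def)
  have "finite (carrier R)" using \<open>finite K\<close> by (simp add: R_def)
  then obtain w where w: "w \<in> carrier (Multiplicative_Group.mult_of R)" "carrier (Multiplicative_Group.mult_of R) = range (\<lambda>i::nat. w [^]\<^bsub>R\<^esub> i)"
    using R.finite_field_mult_group_has_gen by (auto simp only: full_SetCompr_eq UNIV_I simp_thms)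
  have "w [^]\<^bsub>R\<^esub> i = w ^ i" for i :: nat
    by (induction i) (simp_all add: R_def nat_pow_def mult.commute)
  moreover have "carrier (Multiplicative_Group.mult_of R) = K - {0}"
    by (simp add: R_def)
  ultimately have "w \<in> K" "K - {0} = range (\<lambda>i::nat. w ^ i)" using w by auto
  then show ?thesis by blast
qed

section \<open>Elementary abelian groups of exponent two\<close>

lemma group_Z2_power: "group (Z2_power k)"
  by simp

lemma order_Z2_power: "order (Z2_power k) = 2 ^ k"
  by (simp add: Coset.order_def card_PiE carrier_integer_mod_group)

lemma Z2_power_exponent:
  "a \<otimes>\<^bsub>Z2_power k\<^esub> a = \<one>\<^bsub>Z2_power k\<^esub>"
  by (auto simp: fun_eq_iff)

text \<open>Embeddings are built one factor at a time: as long as the image is not all of \<open>G\<close>, an element \<open>x\<close>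
  outside it can serve as the image of the next generator. Injectivity persists because \<open>x = inv x\<close> is
  not in the image.\<close>

lemma (in group) ex_mono_Z2_power:
  assumes exp2: "\<And>x. x \<in> carrier G \<Longrightarrow> x \<otimes> x = \<one>" and order: "order G = 2 ^ k" and "l \<le> k"
  shows "\<exists>\<phi> \<in> hom (Z2_power l) G. inj_on \<phi> (carrier (Z2_power l))"
  using \<open>l \<le> k\<close>
proof (induction l)
  case 0
  show ?case
    by (intro bexI[of _ "\<lambda>_. \<one>"]) (auto simp: hom_def)
next
  case (Suc l)
  then obtain \<phi> where \<phi>: "\<phi> \<in> hom (Z2_power l) G" "inj_on \<phi> (carrier (Z2_power l))"
    by auto
  have fin: "finite (carrier G)"
    using order order_gt_0_iff_finite by simp
  have inv: "inv x = x" if "x \<in> carrier G" for x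
    using that exp2 by (intro inv_equality) auto
  have comm: "x \<otimes> y = y \<otimes> x" if "x \<in> carrier G" "y \<in> carrier G" for x y
    using inv_mult_group[OF that] inv that by simp
  interpret \<phi>: group_hom "Z2_power l" G \<phi>
    using \<phi>(1) by (intro group_hom.intro group_hom_axioms.intro is_group group_Z2_power)
  have in_G: "\<phi> a \<in> carrier G" if "a \<in> carrier (Z2_power l)" for a
    using that by (rule \<phi>.hom_closed)
  have "card (\<phi> ` carrier (Z2_power l)) = 2 ^ l"
    using card_image[OF \<phi>(2)] order_Z2_power[of l] by (simp only: Coset.order_def)
  also have "\<dots> < card (carrier G)"
    using order Suc.prems by (simp add: Coset.order_def)
  finally have "\<not> carrier G \<subseteq> \<phi> ` carrier (Z2_power l)"
    using card_mono[of "\<phi> ` carrier (Z2_power l)" "carrier G"] fin in_G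
    by (metis card.infinite leD not_less_zero card_gt_0_iff finite_subset image_subsetI)
  then obtain x where x: "x \<in> carrier G" "x \<notin> \<phi> ` carrier (Z2_power l)" by blast
  define cut where "cut a = restrict a {..<l}" for a :: "nat \<Rightarrow> int"
  define \<psi> where "\<psi> a = \<phi> (cut a) \<otimes> (if a l = 1 then x else \<one>)" for a :: "nat \<Rightarrow> int"
  have cut_in: "cut a \<in> carrier (Z2_power l)" if "a \<in> carrier (Z2_power (Suc l))" for a
    using that by (auto simp: cut_def PiE_iff)
  have digit: "a l = 0 \<or> a l = 1" if "a \<in> carrier (Z2_power (Suc l))" for a
    using that by (force simp: PiE_iff carrier_integer_mod_group)
  have hom: "\<psi> \<in> hom (Z2_power (Suc l)) G"
  proof (rule homI)
    fix a assume "a \<in> carrier (Z2_power (Suc l))"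
    then show "\<psi> a \<in> carrier G" using x(1) in_G[OF cut_in] by (simp add: \<psi>_def)
  next
    fix a b assume ab: "a \<in> carrier (Z2_power (Suc l))" "b \<in> carrier (Z2_power (Suc l))"
    have "cut (a \<otimes>\<^bsub>Z2_power (Suc l)\<^esub> b) = cut a \<otimes>\<^bsub>Z2_power l\<^esub> cut b"
      by (auto simp: cut_def fun_eq_iff)
    then have cut: "\<phi> (cut (a \<otimes>\<^bsub>Z2_power (Suc l)\<^esub> b)) = \<phi> (cut a) \<otimes> \<phi> (cut b)"
      using \<phi>.hom_mult[OF cut_in cut_in] ab by simp
    have top: "(a \<otimes>\<^bsub>Z2_power (Suc l)\<^esub> b) l = (a l + b l) mod 2"
      by simp
    have "\<phi> (cut a) \<in> carrier G" "\<phi> (cut b) \<in> carrier G" using ab in_G[OF cut_in] by auto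
    moreover from this have "(\<phi> (cut a) \<otimes> x) \<otimes> (\<phi> (cut b) \<otimes> x) = \<phi> (cut a) \<otimes> \<phi> (cut b) \<otimes> (x \<otimes> x)"
      using x(1) comm[of x "\<phi> (cut b)"] by (metis m_assoc m_closed)
    ultimately show "\<psi> (a \<otimes>\<^bsub>Z2_power (Suc l)\<^esub> b) = \<psi> a \<otimes> \<psi> b"
      unfolding \<psi>_def cut top
      using digit[OF ab(1)] digit[OF ab(2)] x(1) exp2 comm[of x "\<phi> (cut b)"]
      by (auto simp: m_assoc)
  qed
  interpret \<psi>: group_hom "Z2_power (Suc l)" G \<psi>
    using hom by (intro group_hom.intro group_hom_axioms.intro is_group group_Z2_power)
  have "a = \<one>\<^bsub>Z2_power (Suc l)\<^esub>" if a: "a \<in> carrier (Z2_power (Suc l))" and ker: "\<psi> a = \<one>" for a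
  proof -
    have "a l \<noteq> 1"
    proof
      assume "a l = 1"
      then have "inv \<phi> (cut a) = x"
        using ker x(1) in_G[OF cut_in[OF a]] comm[of x] by (intro inv_equality) (simp_all add: \<psi>_def)
      then show False using x(2) inv in_G[OF cut_in[OF a]] cut_in[OF a] by auto
    qed
    then have "a l = 0" using digit[OF a] by simp
    then have "\<phi> (cut a) = \<one>" using ker in_G[OF cut_in[OF a]] by (simp add: \<psi>_def)
    then have "cut a = \<one>\<^bsub>Z2_power l\<^esub>"
      using \<phi>(2) cut_in[OF a] unfolding \<phi>.inj_on_one_iff by blast
    then have "a i = 0" if "i < Suc l" for i
      using that \<open>a l = 0\<close> by (auto simp: cut_def fun_eq_iff less_Suc_eq split: if_splits)
    then show ?thesis
      using a by (auto simp: fun_eq_iff PiE_iff extensional_def)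
  qed
  then have "inj_on \<psi> (carrier (Z2_power (Suc l)))"
    unfolding \<psi>.inj_on_one_iff by blast
  then show ?case using hom by blast
qed

lemma (in group) Z2_power_iso:
  assumes "\<And>x. x \<in> carrier G \<Longrightarrow> x \<otimes> x = \<one>" "order G = 2 ^ k"
  shows "\<exists>\<phi>. \<phi> \<in> iso G (Z2_power k)"
proof -
  obtain \<phi> where \<phi>: "\<phi> \<in> hom (Z2_power k) G" "inj_on \<phi> (carrier (Z2_power k))"
    using ex_mono_Z2_power[OF assms order_refl] by blast
  have fin: "finite (carrier G)"
    using assms(2) order_gt_0_iff_finite by simp
  have "\<phi> ` carrier (Z2_power k) \<subseteq> carrier G"
    using \<phi>(1) by (auto simp only: hom_def image_subset_iff Pi_iff mem_Collect_eq)
  moreover have "card (\<phi> ` carrier (Z2_power k)) = card (carrier G)"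
    using card_image[OF \<phi>(2)] order_Z2_power[of k] assms(2) by (simp only: Coset.order_def)
  ultimately have "\<phi> ` carrier (Z2_power k) = carrier G"
    using fin card_subset_eq by blast
  then have "\<phi> \<in> iso (Z2_power k) G"
    using \<phi> by (simp only: iso_def bij_betw_def mem_Collect_eq simp_thms)
  then show ?thesis
    using group.iso_set_sym[OF group_Z2_power] by blast
qed

section \<open>Elementary abelian two-groups have cyclic D-sequences\<close>

lemma ex_char_2_subgroup_cyclic_D_sequence:
  "\<exists>K :: bit alg_closure set. char_2_subgroup K \<and> card K = 2 ^ k \<and> (\<exists>gs. cyclic_D_sequence (additive_group K) gs)"
proof -
  have char: "(1::bit alg_closure) + 1 = 0"
    by (metis to_ac_0 to_ac_1 to_ac_add one_add_one bit_2_eq_0)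
  consider "k = 0" | "k = 1" | "k \<ge> 2" by linarith
  then show ?thesis
  proof cases
    case 1
    interpret char_2_subgroup "{0 :: bit alg_closure}"
      using char by unfold_locales auto
    have "cyclic_D_sequence (additive_group {0 :: bit alg_closure}) [0, 0]"
      by (intro cyclic_D_sequence_additiveI) auto
    then show ?thesis using char_2_subgroup_axioms 1 by (intro exI[of _ "{0}"]) auto
  next
    case 2
    interpret char_2_subgroup "{0, 1 :: bit alg_closure}"
      using char by unfold_locales auto
    have "cyclic_D_sequence (additive_group {0, 1 :: bit alg_closure}) [0, 1, 1, 0]"
      using char by (intro cyclic_D_sequence_additiveI) auto
    then show ?thesis using char_2_subgroup_axioms 2 by (intro exI[of _ "{0, 1}"]) auto
  next
    case 3
    define K where "K = {x :: bit alg_closure. x ^ 2 ^ k = x}"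
    have card: "card K = 2 ^ k"
      using card_frobenius_fixed_points[OF char, of k] 3 by (simp add: K_def)
    then have fin: "finite K" by (simp add: card_ge_0_finite)
    interpret char_2_subfield K
      using char fin by unfold_locales
        (simp_all add: K_def char_2_power_add power_mult_distrib power_inverse zero_power)
    have card_4: "card K \<ge> 4"
      using power_increasing[OF 3, of "2::nat"] card by simp
    have "- x = x" for x :: "bit alg_closure"
      using add_self[of x] by (simp add: minus_unique)
    then obtain w where w: "w \<in> K" "K - {0} = range (\<lambda>i::nat. w ^ i)"
      using finite_field_has_generator[of K] fin zero one add mult inverse by metis
    define M where "M = card K - 1"
    have "w \<noteq> 0" using w(2) by (metis DiffD2 insertI1 power_one_right rangeI)
    have "w ^ card K = w" using w(1) card by (simp add: K_def)
    then have w_M: "w ^ M = 1"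
      using \<open>w \<noteq> 0\<close> card_4 power_minus_mult[of "card K" w] by (simp add: M_def)
    \<comment> \<open>Exponents matter only modulo \<open>M\<close>, so the \<open>M\<close> first powers already give all \<open>M\<close> nonzero
      elements and are therefore distinct.\<close>
    have "w ^ i = w ^ (i mod M)" for i
    proof -
      have "w ^ i = w ^ (M * (i div M) + i mod M)" by simp
      also have "\<dots> = w ^ (i mod M)" by (simp only: power_add power_mult w_M power_one mult_1_left)
      finally show ?thesis .
    qed
    moreover have "i mod M < M" for i using card_4 by (simp add: M_def)
    ultimately have img: "(^) w ` {..<M} = K - {0}"
      unfolding w(2) by (auto simp: image_iff)
    then have "inj_on ((^) w) {..<M}"
      using zero fin by (intro eq_card_imp_inj_on) (simp_all add: M_def)
    then show ?thesis
      using ex_cyclic_D_sequence[of w] w_M img card card_4 char_2_subgroup_axioms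
      by (intro exI[of _ K]) (auto simp: bij_betw_def M_def)
  qed
qed

theorem Z2_power_cyclic_D_sequence: "\<exists>h. cyclic_D_sequence (Z2_power k) h"
proof -
  obtain K :: "bit alg_closure set" and gs where K: "char_2_subgroup K" "card K = 2 ^ k"
    and gs: "cyclic_D_sequence (additive_group K) gs"
    using ex_char_2_subgroup_cyclic_D_sequence by blast
  interpret char_2_subgroup K by fact
  interpret G: group "additive_group K" by (rule group_additive)
  obtain \<phi> where "\<phi> \<in> iso (additive_group K) (Z2_power k)"
    using G.Z2_power_iso[of k] K(2) by (auto simp: Coset.order_def)
  then show ?thesis
    using cyclic_D_sequence_iso[OF group_additive group_Z2_power _ gs] by blast
qed

theorem lemma17:
  fixes N :: "('a, 'b) monoid_scheme" and k :: nat
  assumes "group N" and "finite (carrier N)" and "odd (order N)" and "sequenceable N"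
  shows "\<exists>gs. cyclic_D_sequence (N \<times>\<times> Z2_power k) gs"
proof -
  obtain h where "cyclic_D_sequence (Z2_power k) h"
    using Z2_power_cyclic_D_sequence by blast
  moreover have "finite (carrier (Z2_power k))"
    by (simp add: carrier_integer_mod_group finite_PiE)
  ultimately show ?thesis
    using cyclic_D_sequence_DirProd[OF assms(1,3,4) group_Z2_power _ Z2_power_exponent] by blast
qed

end
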